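(* Let $\{a_s\}_{s\in S}$ be a numeric array of complex numbers and let $\kappa\ge 0$. If $\{a_s\}_{s\in S}$ has a greedy $\kappa$-sum equal to $A\in\mathbb{C}$, then for every $\kappa'>\kappa$ the array $\{a_s\}_{s\in S}$ has a greedy $\kappa'$-sum.
   Context: A numeric array $\{a_s\}_{s\in S}$ is a family of complex numbers indexed by a set $S$ (no ordering of $S$ is given), such that for every $\varepsilon>0$ the set $\{s\in S: |a_s|>\varepsilon\}$ is finite. For $\kappa>0$ the array is called greedy $\kappa$-summable if the limit $$\lim_{\varepsilon\to 0^+}\ \sum_{s\in S,\ |a_s|>\varepsilon} a_s\left(1-\frac{\varepsilon}{|a_s|}\right)^{\kappa}$$ exists (as a finite complex number); this limit is then called the greedy $\kappa$-sum of the array. For $\kappa=0$ the greedy $0$-sum is the greedy sum $\lim_{\varepsilon\to 0^+}\sum_{|a_s|>\varepsilon}a_s$, when this limit exists. *)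

theory Defs
  imports Complex_Main
begin

definition numeric_array :: "'s set \<Rightarrow> ('s \<Rightarrow> complex) \<Rightarrow> bool" where
  "numeric_array S a \<longleftrightarrow> (\<forall>\<epsilon>>0. finite {s \<in> S. norm (a s) > \<epsilon>})"

(* On the summation range the base 1 - \<epsilon> / norm (a s) lies strictly between 0 and 1 (for \<epsilon> > 0),
   so for \<kappa> = 0 every weight is 1 and this is the plain greedy partial sum. *)
definition greedy_mean :: "real \<Rightarrow> 's set \<Rightarrow> ('s \<Rightarrow> complex) \<Rightarrow> real \<Rightarrow> complex" where
  "greedy_mean \<kappa> S a \<epsilon> =
     (\<Sum>s\<in>{s \<in> S. norm (a s) > \<epsilon>}. a s * complex_of_real ((1 - \<epsilon> / norm (a s)) powr \<kappa>))"

definition has_greedy_sum :: "real \<Rightarrow> 's set \<Rightarrow> ('s \<Rightarrow> complex) \<Rightarrow> complex \<Rightarrow> bool" where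
  "has_greedy_sum \<kappa> S a A \<longleftrightarrow> (greedy_mean \<kappa> S a \<longlongrightarrow> A) (at_right 0)"

definition greedy_summable :: "real \<Rightarrow> 's set \<Rightarrow> ('s \<Rightarrow> complex) \<Rightarrow> bool" where
  "greedy_summable \<kappa> S a \<longleftrightarrow> (\<exists>A. has_greedy_sum \<kappa> S a A)"

end

theory Submission
  imports Defs "HOL-Analysis.Gamma_Function"
begin

text \<open>
  Substituting \<open>\<lambda> = 1 / \<bar>a s\<bar>\<close> and \<open>\<omega> = 1 / \<epsilon>\<close>, the greedy means are the Riesz typical means
  \<open>\<Sum>\<^bsub>\<lambda> < \<omega>\<^esub> a s (1 - \<lambda> / \<omega>)\<^sup>\<kappa>\<close>, and the theorem is the classical consistency theorem for
  them, with the same sum \<open>A\<close>. The means of order \<open>\<kappa>'\<close> are averages of those of order \<open>\<kappa>\<close>: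
  writing \<open>\<delta> = \<kappa>' - \<kappa> > 0\<close> and \<open>M\<^sub>\<kappa>(\<epsilon>)\<close> for the greedy mean,
  \<open>B(\<kappa> + 1, \<delta>) M\<^bsub>\<kappa>'\<^esub>(\<epsilon>)\<close> is the integral over \<open>0 < t < 1\<close> of
  \<open>t\<^sup>\<kappa> (1 - t)\<^bsup>\<delta> - 1\<^esup> M\<^sub>\<kappa>(\<epsilon> / t)\<close>, where \<open>B\<close> is Euler's Beta function.
  For fixed \<open>\<epsilon>\<close> only the finitely many entries exceeding \<open>\<epsilon>\<close> enter the integrand, so the identity
  (\<open>greedy_mean_beta_average\<close>) holds term by term, each term being a rescaled Beta
  integral (\<open>has_integral_truncated_Beta\<close>).

  As \<open>\<epsilon>\<close> tends to 0, \<open>M\<^sub>\<kappa>(\<epsilon> / t)\<close> tends to \<open>A\<close> for each fixed \<open>t\<close>. Moreover \<open>M\<^sub>\<kappa>\<close>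
  is bounded on the whole half-line (\<open>greedy_mean_bounded\<close>): near 0 because it converges,
  and away from 0 because it involves only finitely many entries with weights at most 1.
  By dominated convergence the integral therefore tends to \<open>B(\<kappa> + 1, \<delta>) A\<close>.
\<close>

text \<open>
  The weight of order \<open>\<kappa>\<close> at \<open>p / t\<close>, multiplied by \<open>t\<^sup>\<kappa>\<close>, is \<open>(t - p)\<^sup>\<kappa>\<close>, so the affine map of
  \<open>[p, 1]\<close> onto \<open>[0, 1]\<close> reduces the integral to Euler's Beta integral.
\<close>

lemma has_integral_truncated_Beta:
  fixes p \<kappa> \<delta> :: real
  assumes p: "0 \<le> p" "p < 1" and \<kappa>: "\<kappa> > -1" and \<delta>: "\<delta> > 0"
  shows "((\<lambda>t. if p < t then t powr \<kappa> * (1 - t) powr (\<delta> - 1) * (1 - p / t) powr \<kappa> else 0)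
           has_integral Beta (\<kappa> + 1) \<delta> * (1 - p) powr (\<kappa> + \<delta>)) {0..1}"
proof -
  define q where "q = 1 - p"
  have q: "q > 0" and q_eq: "q + p = 1" using p by (simp_all add: q_def)
  have "((\<lambda>u. u powr \<kappa> * (1 - u) powr (\<delta> - 1)) has_integral Beta (\<kappa> + 1) \<delta>) (cbox 0 1)"
    using has_integral_Beta_real[of "\<kappa> + 1" \<delta>] \<kappa> \<delta> by simp
  from has_integral_affinity'[OF this, of "1 / q" "- p / q"]
  have "((\<lambda>t. (t / q - p / q) powr \<kappa> * (1 - (t / q - p / q)) powr (\<delta> - 1))
           has_integral q * Beta (\<kappa> + 1) \<delta>) {p..1}"
    using q by (simp add: distrib_left right_diff_distrib q_eq)
  from has_integral_mult_right[OF this, of "q powr (\<kappa> + \<delta> - 1)"]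
  have "((\<lambda>t. q powr (\<kappa> + \<delta> - 1) *
              ((t / q - p / q) powr \<kappa> * (1 - (t / q - p / q)) powr (\<delta> - 1)))
           has_integral Beta (\<kappa> + 1) \<delta> * q powr (\<kappa> + \<delta>)) {p..1}"
    using q by (simp add: powr_diff mult_ac)
  moreover have "q powr (\<kappa> + \<delta> - 1) *
       ((t / q - p / q) powr \<kappa> * (1 - (t / q - p / q)) powr (\<delta> - 1)) =
     (if p < t then t powr \<kappa> * (1 - t) powr (\<delta> - 1) * (1 - p / t) powr \<kappa> else 0)"
    (is "?l = ?r") if t: "t \<in> {p..1}" for t
  proof (cases "p < t")
    case True
    have 1: "t / q - p / q = (t - p) / q" "1 - (t / q - p / q) = (1 - t) / q"
      using q q_eq by (simp_all add: field_simps)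
    have "t * (1 - p / t) = t - p" using True p by (simp add: field_simps)
    hence 2: "t powr \<kappa> * (1 - p / t) powr \<kappa> = (t - p) powr \<kappa>"
      using True p by (simp add: powr_mult [symmetric])
    have "?l = q powr (\<kappa> + (\<delta> - 1)) *
        ((t - p) powr \<kappa> / q powr \<kappa> * ((1 - t) powr (\<delta> - 1) / q powr (\<delta> - 1)))"
      unfolding 1(2) unfolding 1(1) using True t q by (simp add: powr_divide add_diff_eq)
    also have "\<dots> = (t - p) powr \<kappa> * (1 - t) powr (\<delta> - 1)"
      unfolding powr_add using q by simp
    finally show ?thesis using True by (simp add: 2 [symmetric] mult_ac)
  next
    case False
    with t show ?thesis by simp
  qed
  ultimately have "((\<lambda>t. if p < t then t powr \<kappa> * (1 - t) powr (\<delta> - 1) * (1 - p / t) powr \<kappa> else 0)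
           has_integral Beta (\<kappa> + 1) \<delta> * q powr (\<kappa> + \<delta>)) {p..1}"
    by (rule has_integral_eq[rotated])
  hence "((\<lambda>t. if t \<in> {p..1}
             then if p < t then t powr \<kappa> * (1 - t) powr (\<delta> - 1) * (1 - p / t) powr \<kappa> else 0
             else 0)
           has_integral Beta (\<kappa> + 1) \<delta> * q powr (\<kappa> + \<delta>)) {0..1}"
    by (subst has_integral_restrict) (use p in auto)
  thus ?thesis
    unfolding q_def by (rule has_integral_eq[rotated]) auto
qed

text \<open>
  For \<open>0 < t < 1\<close> the range of the mean at \<open>\<epsilon> / t\<close> lies inside the finite range of the mean at
  \<open>\<epsilon>\<close>, so sum and integral may be exchanged. At \<open>t = 0\<close> and \<open>t = 1\<close> the kernel is 0 because
  \<open>0 powr x = 0\<close> for every exponent, including 0.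
\<close>

lemma greedy_mean_beta_average:
  assumes S: "numeric_array S a" and \<kappa>: "\<kappa> > -1" and \<delta>: "\<delta> > 0" and \<epsilon>: "\<epsilon> > 0"
  shows "((\<lambda>t. (t powr \<kappa> * (1 - t) powr (\<delta> - 1)) *\<^sub>R greedy_mean \<kappa> S a (\<epsilon> / t))
           has_integral Beta (\<kappa> + 1) \<delta> *\<^sub>R greedy_mean (\<kappa> + \<delta>) S a \<epsilon>) {0..1}"
proof -
  define F where "F = {s \<in> S. norm (a s) > \<epsilon>}"
  have fin: "finite F" using S \<epsilon> by (simp add: numeric_array_def F_def)
  let ?k = "\<lambda>s t. if \<epsilon> / norm (a s) < t
      then t powr \<kappa> * (1 - t) powr (\<delta> - 1) * (1 - \<epsilon> / norm (a s) / t) powr \<kappa> else 0"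
  have "((\<lambda>t. ?k s t *\<^sub>R a s) has_integral
          (Beta (\<kappa> + 1) \<delta> * (1 - \<epsilon> / norm (a s)) powr (\<kappa> + \<delta>)) *\<^sub>R a s) {0..1}"
    if "s \<in> F" for s
    by (intro has_integral_scaleR_left has_integral_truncated_Beta)
       (use that \<epsilon> \<kappa> \<delta> in \<open>auto simp: F_def divide_less_eq\<close>)
  from has_integral_sum[where f = "\<lambda>s t. ?k s t *\<^sub>R a s", OF fin this]
  have "((\<lambda>t. \<Sum>s\<in>F. ?k s t *\<^sub>R a s) has_integral
          Beta (\<kappa> + 1) \<delta> *\<^sub>R greedy_mean (\<kappa> + \<delta>) S a \<epsilon>) {0..1}"
    by (simp add: greedy_mean_def F_def sum_distrib_left scaleR_conv_of_real mult_ac)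
  moreover have "(\<Sum>s\<in>F. ?k s t *\<^sub>R a s) =
      (t powr \<kappa> * (1 - t) powr (\<delta> - 1)) *\<^sub>R greedy_mean \<kappa> S a (\<epsilon> / t)" if t: "t \<in> {0..1}" for t
  proof (cases "t = 0 \<or> t = 1")
    case True
    hence kernel: "t powr \<kappa> * (1 - t) powr (\<delta> - 1) = 0" by auto
    have "(\<Sum>s\<in>F. ?k s t *\<^sub>R a s) = 0"
      by (rule sum.neutral) (simp only: kernel mult_zero_left if_cancel scaleR_zero_left, simp)
    thus ?thesis unfolding kernel by simp
  next
    case False
    with t have t: "0 < t" "t < 1" by auto
    have *: "\<epsilon> < \<epsilon> / t" using t \<epsilon> by (simp add: field_simps)
    have "\<epsilon> / t < x \<longleftrightarrow> \<epsilon> < x \<and> \<epsilon> / x < t" for x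
    proof (cases "\<epsilon> < x")
      case True
      hence "x > 0" using \<epsilon> by linarith
      with True t show ?thesis by (simp add: divide_less_eq mult.commute)
    next
      case False
      with * show ?thesis by linarith
    qed
    hence range: "{s \<in> S. norm (a s) > \<epsilon> / t} = {s \<in> F. \<epsilon> / norm (a s) < t}"
      by (auto simp: F_def)
    have "greedy_mean \<kappa> S a (\<epsilon> / t) = (\<Sum>s\<in>F. if \<epsilon> / norm (a s) < t
        then a s * complex_of_real ((1 - \<epsilon> / t / norm (a s)) powr \<kappa>) else 0)"
      unfolding greedy_mean_def range by (rule sum.inter_filter[OF fin])
    thus ?thesis
      by (auto simp: sum_distrib_left scaleR_conv_of_real mult_ac intro!: sum.cong)
  qed
  ultimately show ?thesis
    by (rule has_integral_eq[rotated])
qed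

text \<open>
  Convergence at 0 bounds the mean on some \<open>(0, \<eta>)\<close>. From \<open>\<eta>\<close> on, only the finitely many
  entries exceeding \<open>\<eta>\<close> contribute, each with a weight in \<open>[0, 1]\<close>.
\<close>

lemma greedy_mean_bounded:
  assumes S: "numeric_array S a" and \<kappa>: "\<kappa> \<ge> 0" and A: "has_greedy_sum \<kappa> S a A"
  obtains B where "\<And>\<epsilon>. \<epsilon> > 0 \<Longrightarrow> norm (greedy_mean \<kappa> S a \<epsilon>) \<le> B"
proof -
  have "\<forall>\<^sub>F \<epsilon> in at_right 0. dist (greedy_mean \<kappa> S a \<epsilon>) A < 1"
    using A unfolding has_greedy_sum_def by (rule tendstoD) simp
  then obtain \<eta> where \<eta>: "\<eta> > 0"
    and near: "\<And>\<epsilon>. 0 < \<epsilon> \<Longrightarrow> \<epsilon> < \<eta> \<Longrightarrow> dist (greedy_mean \<kappa> S a \<epsilon>) A < 1"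
    unfolding eventually_at_right_field by auto
  define C where "C = (\<Sum>s | s \<in> S \<and> norm (a s) > \<eta>. norm (a s))"
  have C: "C \<ge> 0" unfolding C_def by (rule sum_nonneg) simp
  have "norm (greedy_mean \<kappa> S a \<epsilon>) \<le> norm A + 1 + C" if \<epsilon>: "\<epsilon> > 0" for \<epsilon>
  proof (cases "\<epsilon> < \<eta>")
    case True
    have "norm (greedy_mean \<kappa> S a \<epsilon>) \<le> norm A + dist (greedy_mean \<kappa> S a \<epsilon>) A"
      unfolding dist_norm by (rule norm_triangle_sub)
    with near[OF \<epsilon> True] C show ?thesis by linarith
  next
    case False
    have "norm (greedy_mean \<kappa> S a \<epsilon>) \<le> (\<Sum>s | s \<in> S \<and> norm (a s) > \<epsilon>. norm (a s))"
      unfolding greedy_mean_def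
    proof (rule sum_norm_le)
      fix s assume "s \<in> {s \<in> S. norm (a s) > \<epsilon>}"
      hence "0 \<le> 1 - \<epsilon> / norm (a s)" "1 - \<epsilon> / norm (a s) \<le> 1"
        using \<epsilon> by (auto simp: divide_le_eq)
      hence "(1 - \<epsilon> / norm (a s)) powr \<kappa> \<le> 1" using \<kappa> by (intro powr_le1) auto
      thus "norm (a s * complex_of_real ((1 - \<epsilon> / norm (a s)) powr \<kappa>)) \<le> norm (a s)"
        by (simp add: norm_mult mult_left_le)
    qed
    also have "\<dots> \<le> C"
      unfolding C_def
      by (rule sum_mono2) (use S \<eta> False in \<open>auto simp: numeric_array_def\<close>)
    finally show ?thesis by (smt (verit) norm_ge_zero)
  qed
  thus thesis by (rule that)
qed

theorem has_greedy_sum_higher_order: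
  assumes S: "numeric_array S a" and \<kappa>: "\<kappa> \<ge> 0" and A: "has_greedy_sum \<kappa> S a A"
    and less: "\<kappa> < \<kappa>'"
  shows "has_greedy_sum \<kappa>' S a A"
  unfolding has_greedy_sum_def
proof (rule tendsto_at_right_sequentially[OF zero_less_one])
  fix e :: "nat \<Rightarrow> real"
  assume pos: "\<And>n. 0 < e n" and lim: "e \<longlonglongrightarrow> 0"
  define \<delta> where "\<delta> = \<kappa>' - \<kappa>"
  have \<delta>: "\<delta> > 0" and \<kappa>': "\<kappa>' = \<kappa> + \<delta>" using less by (simp_all add: \<delta>_def)
  define w where "w = (\<lambda>t::real. t powr \<kappa> * (1 - t) powr (\<delta> - 1))"
  define f where "f = (\<lambda>n t. w t *\<^sub>R greedy_mean \<kappa> S a (e n / t))"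
  define b where "b = Beta (\<kappa> + 1) \<delta>"
  have b: "b > 0"
    unfolding b_def Beta_def using \<kappa> \<delta> by (intro divide_pos_pos mult_pos_pos Gamma_real_pos) auto
  have w: "(w has_integral b) {0..1}"
    using has_integral_Beta_real[of "\<kappa> + 1" \<delta>] \<kappa> \<delta> by (simp add: w_def b_def)
  have f: "(f n has_integral b *\<^sub>R greedy_mean \<kappa>' S a (e n)) {0..1}" for n
    unfolding f_def w_def b_def \<kappa>'
    by (rule greedy_mean_beta_average[OF S _ \<delta> pos]) (use \<kappa> in simp)
  obtain B where B: "\<And>\<epsilon>. \<epsilon> > 0 \<Longrightarrow> norm (greedy_mean \<kappa> S a \<epsilon>) \<le> B"
    using greedy_mean_bounded[OF S \<kappa> A] by blast
  have "(\<lambda>n. integral {0..1} (f n)) \<longlonglongrightarrow> integral {0..1} (\<lambda>t. w t *\<^sub>R A)"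
  proof (rule dominated_convergence(2))
    show "f n integrable_on {0..1}" for n using f by blast
    show "(\<lambda>t. w t * B) integrable_on {0..1}"
      using has_integral_mult_left[OF w] by blast
    show "norm (f n t) \<le> w t * B" if "t \<in> {0..1}" for n t
    proof (cases "t = 0")
      case False
      with that have "norm (greedy_mean \<kappa> S a (e n / t)) \<le> B" by (intro B) (simp add: pos)
      moreover have "w t \<ge> 0" by (simp add: w_def)
      ultimately show ?thesis by (simp add: f_def mult_left_mono)
    qed (simp add: f_def w_def)
    show "(\<lambda>n. f n t) \<longlonglongrightarrow> w t *\<^sub>R A" if "t \<in> {0..1}" for t
    proof (cases "t = 0")
      case False
      with that have t: "t > 0" by simp
      have "(\<lambda>n. e n / t) \<longlonglongrightarrow> 0" using tendsto_divide_zero[OF lim] .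
      hence "filterlim (\<lambda>n. e n / t) (at_right 0) sequentially"
        by (simp add: filterlim_at pos t less_imp_neq [THEN not_sym])
      hence "(\<lambda>n. greedy_mean \<kappa> S a (e n / t)) \<longlonglongrightarrow> A"
        using A unfolding has_greedy_sum_def by (rule filterlim_compose[rotated])
      thus ?thesis unfolding f_def by (intro tendsto_intros)
    qed (simp add: f_def w_def)
  qed
  moreover have "integral {0..1} (f n) = b *\<^sub>R greedy_mean \<kappa>' S a (e n)" for n
    using f by (rule integral_unique)
  moreover have "integral {0..1} (\<lambda>t. w t *\<^sub>R A) = b *\<^sub>R A"
    using has_integral_scaleR_left[OF w] by (rule integral_unique)
  ultimately have "(\<lambda>n. b *\<^sub>R greedy_mean \<kappa>' S a (e n)) \<longlonglongrightarrow> b *\<^sub>R A" by simp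
  from tendsto_scaleR[OF tendsto_const[of "inverse b"] this] b
  show "(\<lambda>n. greedy_mean \<kappa>' S a (e n)) \<longlonglongrightarrow> A" by simp
qed

theorem theorem1:
  fixes S :: "'s set" and a :: "'s \<Rightarrow> complex" and \<kappa> :: real and A :: complex
  assumes "numeric_array S a"
    and "\<kappa> \<ge> 0"
    and "has_greedy_sum \<kappa> S a A"
  shows "\<forall>\<kappa>'>\<kappa>. greedy_summable \<kappa>' S a"
  using has_greedy_sum_higher_order[OF assms] unfolding greedy_summable_def by blast

end
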